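(* Let $A\subset\mathbb{R}$ be an open invex subset with respect to $\eta:A\times A\to\mathbb{R}$ and let $a,b\in A$ with $a<a+\eta(b,a)$. Suppose that $f:A\to\mathbb{R}$ is a differentiable function and that $|f'|^{q}$ is a preinvex function (with respect to $\eta$) on $[a,a+\eta(b,a)]$ for some fixed $q\ge1$. If $f'$ is integrable on $[a,a+\eta(b,a)]$, then for each $x\in[a,a+\eta(b,a)]$ $$\left|f(x)-\frac{1}{\eta(b,a)}\int_{a}^{a+\eta(b,a)}f(u)\,du\right|\le\eta(b,a)\left(\frac12\right)^{1-\frac1q}\big\{T_1+T_2\big\},$$ where $$T_1=\left(\frac{x-a}{\eta(b,a)}\right)^{2\left(1-\frac1q\right)}\left[\frac{(x-a)^{2}\,(3\eta(b,a)-2x+2a)}{6\,\eta(b,a)^{3}}|f'(a)|^{q}+\frac13\left(\frac{x-a}{\eta(b,a)}\right)^{3}|f'(b)|^{q}\right]^{\frac1q},$$ $$T_2=\left(\frac{a+\eta(b,a)-x}{\eta(b,a)}\right)^{2\left(1-\frac1q\right)}\left[\frac13\left(\frac{a+\eta(b,a)-x}{\eta(b,a)}\right)^{3}|f'(a)|^{q}+\left(\frac16+\frac{(x-a)^{2}\,(2x-3\eta(b,a)-2a)}{6\,\eta(b,a)^{3}}\right)|f'(b)|^{q}\right]^{\frac1q}.$$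
   Context: A set $S\subset\mathbb{R}$ is called invex with respect to $\eta$ if $x+t\eta(y,x)\in S$ for all $x,y\in S$ and $t\in[0,1]$. A function $g$ on an invex set $S$ is called preinvex with respect to $\eta$ if $g(x+t\eta(y,x))\le(1-t)g(x)+t\,g(y)$ for all $x,y\in S$ and $t\in[0,1]$.
   Formalization: Preinvexity of |f'|^q is assumed on [a,a+η(b,a)] together with the point b; if b lies outside the interval, preinvexity on the interval alone says nothing about f'(b) and the inequality can fail. *)

theory Defs
  imports "HOL-Analysis.Analysis"
begin

definition invex_wrt :: "(real \<Rightarrow> real \<Rightarrow> real) \<Rightarrow> real set \<Rightarrow> bool" where
  "invex_wrt \<eta> S \<longleftrightarrow> (\<forall>x\<in>S. \<forall>y\<in>S. \<forall>t\<in>{0..1}. x + t * \<eta> y x \<in> S)"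

(* Only the inequality is required; invexity of S is a separate condition.  Thus the
   predicate also makes sense for a subset S of an invex set A on which g is defined,
   where the points x + t * \<eta> y x lie in A but possibly not in S.

   Pitfall: preinvexity on {a..a + \<eta> b a} alone says nothing about g b when b lies outside
   this interval, so a bound involving g b needs the set insert b {a..a + \<eta> b a} (the same
   set when b lies in the interval). *)
definition preinvex_on :: "(real \<Rightarrow> real \<Rightarrow> real) \<Rightarrow> real set \<Rightarrow> (real \<Rightarrow> real) \<Rightarrow> bool" where
  "preinvex_on \<eta> S g \<longleftrightarrow>
     (\<forall>x\<in>S. \<forall>y\<in>S. \<forall>t\<in>{0..1}. g (x + t * \<eta> y x) \<le> (1 - t) * g x + t * g y)"

end

(* With h = \<eta> b a, s = (x - a) / h and g t = f (a + t * h), integration by parts writes the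
   left-hand side without the modulus as the integral of t * g' t over {0..s} plus that of
   (t - 1) * g' t over {s..1}. Preinvexity bounds \<bar>f' (a + t * h)\<bar> powr q by the affine function
   (1 - t) * \<bar>f' a\<bar> powr q + t * \<bar>f' b\<bar> powr q, and the power mean inequality for the weights
   t and 1 - t gives T1 and T2. That inequality comes from Young's inequality with a free
   parameter D, optimized after integration, so f' need not be integrable to the power q. *)
theory Submission imports Defs begin

text \<open>The right-hand side is the tangent line of the concave function u ^ (1 / q) at u =
  \<open>D powr q\<close>, evaluated at u = \<open>k powr q\<close>. Young's inequality with weights
  1 / q and 1 - 1 / q yields it.\<close>

lemma Youngs_inequality_powr_bound:
  fixes k D q :: real
  assumes "k \<ge> 0" "D > 0" "q \<ge> 1"
  shows "k \<le> (1 - 1 / q) * D + D powr (1 - q) / q * k powr q"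
proof (cases "k = 0")
  case True
  then show ?thesis using assms by simp
next
  case False
  with assms have k: "k > 0" by simp
  have "k = (k powr q * D powr (1 - q)) powr (1 / q) * D powr (1 - 1 / q)"
  proof -
    have "(1 - q) * (1 / q) + (1 - 1 / q) = 0"
      using assms by (simp add: field_simps)
    then have "D powr ((1 - q) * (1 / q)) * D powr (1 - 1 / q) = 1"
      using assms by (simp only: powr_add [symmetric]) simp
    then show ?thesis
      using assms k by (simp add: powr_mult powr_powr)
  qed
  also have "\<dots> \<le> 1 / q * (k powr q * D powr (1 - q)) + (1 - 1 / q) * D"
    using assms k by (intro Youngs_inequality_0) auto
  finally show ?thesis by (simp add: algebra_simps)
qed

text \<open>For \<open>Q > 0\<close> and \<open>q > 1\<close> the bound is smallest at
  \<open>D powr q = Q / W\<close>, where its two terms add up to \<open>D * W\<close>. For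
  \<open>Q = 0\<close> and \<open>q > 1\<close> the infimum is only approached as \<open>D\<close>
  tends to 0, hence the separate case.\<close>

lemma power_mean_optimize:
  fixes E W Q q :: real
  assumes bound: "\<And>D. D > 0 \<Longrightarrow> E \<le> (1 - 1 / q) * D * W + D powr (1 - q) / q * Q"
    and "W > 0" "Q \<ge> 0" "q \<ge> 1"
  shows "E \<le> W powr (1 - 1 / q) * Q powr (1 / q)"
proof (cases "Q = 0")
  case True
  have "E \<le> 0"
  proof (rule ccontr)
    assume "\<not> E \<le> 0"
    then have "E > 0" by simp
    \<comment> \<open>Taking \<open>D = E / W\<close> bounds \<open>E\<close> by a multiple of
      itself with factor below 1; this replaces the limit of \<open>D\<close> to 0.\<close>
    with bound[of "E / W"] True \<open>W > 0\<close> have "E \<le> (1 - 1 / q) * E" by simp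
    then have "E / q \<le> 0" by (simp add: algebra_simps)
    with \<open>E > 0\<close> \<open>q \<ge> 1\<close> show False by (simp add: divide_le_0_iff)
  qed
  then show ?thesis using True by simp
next
  case False
  with assms have Q: "Q > 0" by simp
  define D where "D = (Q / W) powr (1 / q)"
  have D: "D > 0" using Q assms by (simp add: D_def)
  have Dq: "D powr q = Q / W" using Q assms by (simp add: D_def powr_powr)
  have "D powr (1 - q) * Q = D * W"
    using D Q assms by (simp add: powr_diff Dq)
  then have "D powr (1 - q) / q * Q = D * W / q" by (simp only: times_divide_eq_left)
  with bound[OF D] have "E \<le> (1 - 1 / q) * D * W + D * W / q" by (simp only:)
  then have "E \<le> D * W" by (simp add: algebra_simps)
  also have "D * W = W powr (1 - 1 / q) * Q powr (1 / q)"
    using Q assms by (simp add: D_def powr_divide powr_diff)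
  finally show ?thesis .
qed

text \<open>Weighted power mean inequality for the integral of \<open>w t * k t\<close>, written as
  an increment of its antiderivative \<open>F\<close>. \<open>W\<close> is the total weight; only
  the majorant \<open>p\<close> is integrated, never \<open>\<bar>k t\<bar> powr q\<close>
  itself.\<close>

lemma increment_le_power_mean:
  fixes F w k p :: "real \<Rightarrow> real" and c d W Q q :: real
  assumes "c \<le> d" "q \<ge> 1" "W > 0"
    and der: "\<And>t. t \<in> {c..d} \<Longrightarrow> (F has_real_derivative w t * k t) (at t within {c..d})"
    and W: "((\<lambda>t. \<bar>w t\<bar>) has_integral W) {c..d}"
    and Q: "((\<lambda>t. \<bar>w t\<bar> * p t) has_integral Q) {c..d}"
    and p: "\<And>t. t \<in> {c..d} \<Longrightarrow> \<bar>k t\<bar> powr q \<le> p t"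
  shows "\<bar>F d - F c\<bar> \<le> W powr (1 - 1 / q) * Q powr (1 / q)"
proof (rule power_mean_optimize)
  have p0: "p t \<ge> 0" if "t \<in> {c..d}" for t
    using p[OF that] powr_ge_zero order_trans by blast
  show "Q \<ge> 0"
    using p0 by (intro has_integral_nonneg[OF Q]) auto
  have F: "((\<lambda>t. w t * k t) has_integral (F d - F c)) {c..d}"
    using der \<open>c \<le> d\<close>
    by (intro fundamental_theorem_of_calculus)
       (auto simp: has_real_derivative_iff_has_vector_derivative)
  fix D :: real
  assume D: "D > 0"
  \<comment> \<open>Young's bound with one \<open>D\<close> for all \<open>t\<close>, weighted by
    \<open>\<bar>w t\<bar>\<close> and with \<open>p t\<close> in place of the power of
    \<open>\<bar>k t\<bar>\<close>. Its integral is the expression to be optimized over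
    \<open>D\<close>.\<close>
  let ?B = "\<lambda>t. (1 - 1 / q) * D * \<bar>w t\<bar> + D powr (1 - q) / q * (\<bar>w t\<bar> * p t)"
  have B: "(?B has_integral (1 - 1 / q) * D * W + D powr (1 - q) / q * Q) {c..d}"
    by (intro has_integral_add has_integral_mult_right W Q)
  have "norm (w t * k t) \<le> ?B t" if t: "t \<in> {c..d}" for t
  proof -
    have "\<bar>k t\<bar> \<le> (1 - 1 / q) * D + D powr (1 - q) / q * \<bar>k t\<bar> powr q"
      using D \<open>q \<ge> 1\<close> by (intro Youngs_inequality_powr_bound) auto
    also have "\<dots> \<le> (1 - 1 / q) * D + D powr (1 - q) / q * p t"
      using p[OF t] \<open>q \<ge> 1\<close> by (intro add_left_mono mult_left_mono) auto
    finally have "\<bar>w t\<bar> * \<bar>k t\<bar> \<le> \<bar>w t\<bar> * ((1 - 1 / q) * D + D powr (1 - q) / q * p t)"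
      by (intro mult_left_mono) auto
    then show ?thesis by (simp add: abs_mult algebra_simps)
  qed
  with F B have "norm (F d - F c) \<le> (1 - 1 / q) * D * W + D powr (1 - q) / q * Q"
    using integral_norm_bound_integral[of "\<lambda>t. w t * k t" "{c..d}" ?B]
    by (simp add: has_integral_iff)
  then show "\<bar>F d - F c\<bar> \<le> (1 - 1 / q) * D * W + D powr (1 - q) / q * Q" by simp
qed (use assms in auto)

text \<open>Splits a power of the total weight of a kernel piece into the common constant and the
  outer factor of T1 or T2. At \<open>s = 0\<close> both sides are 0, since
  \<open>0 powr r = 0\<close> even for \<open>r = 0\<close>.\<close>

lemma half_square_powr:
  fixes s r :: real
  assumes "s \<ge> 0"
  shows "(s\<^sup>2 / 2) powr r = (1 / 2) powr r * s powr (2 * r)"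
proof (cases "s = 0")
  case False
  with assms have "s\<^sup>2 = s powr 2" by (simp add: powr_numeral)
  then have "(s\<^sup>2 / 2) powr r = (1 / 2 * s powr 2) powr r" by simp
  also have "\<dots> = (1 / 2) powr r * s powr (2 * r)"
    by (simp only: powr_mult powr_powr)
  finally show ?thesis .
qed auto

lemma has_integral_real_FTC:
  fixes P p :: "real \<Rightarrow> real"
  assumes "c \<le> d" "\<And>t. (P has_real_derivative p t) (at t)"
  shows "(p has_integral P d - P c) {c..d}"
  using assms by (intro fundamental_theorem_of_calculus)
    (auto simp: has_real_derivative_iff_has_vector_derivative intro: has_vector_derivative_at_within)

lemma ostrowski_unit_interval:
  fixes g k :: "real \<Rightarrow> real" and s q \<alpha> \<beta> :: real
  assumes s: "s \<in> {0..1}" and q: "q \<ge> 1"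
    and der: "\<And>t. t \<in> {0..1} \<Longrightarrow> (g has_real_derivative k t) (at t within {0..1})"
    and k: "\<And>t. t \<in> {0..1} \<Longrightarrow> \<bar>k t\<bar> powr q \<le> (1 - t) * \<alpha> + t * \<beta>"
  shows "\<bar>g s - integral {0..1} g\<bar> \<le> (1 / 2) powr (1 - 1 / q) *
      (s powr (2 * (1 - 1 / q)) * (s\<^sup>2 * (3 - 2 * s) / 6 * \<alpha> + s ^ 3 / 3 * \<beta>) powr (1 / q)
       + (1 - s) powr (2 * (1 - 1 / q)) *
         ((1 - s) ^ 3 / 3 * \<alpha> + (1 / 6 + s\<^sup>2 * (2 * s - 3) / 6) * \<beta>) powr (1 / q))"
proof -
  let ?J = "\<lambda>t. integral {0..t} g"
  \<comment> \<open>Integration by parts: antiderivatives of \<open>t * k t\<close> and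
    \<open>(t - 1) * k t\<close>. Their difference \<open>?F t - ?G t\<close> is \<open>g t\<close>,
    so switching from one to the other at \<open>s\<close> produces \<open>g s\<close>.\<close>
  let ?F = "\<lambda>t. t * g t - ?J t"
  let ?G = "\<lambda>t. (t - 1) * g t - ?J t"
  have "continuous_on {0..1} g"
    using der by (intro DERIV_continuous_on) auto
  then have J: "(?J has_real_derivative g t) (at t within {0..1})" if "t \<in> {0..1}" for t
    using that by (intro integral_has_real_derivative)
  have F: "(?F has_real_derivative t * k t) (at t within {0..1})"
    and G: "(?G has_real_derivative (t - 1) * k t) (at t within {0..1})" if "t \<in> {0..1}" for t
    by (auto intro!: derivative_eq_intros der[OF that] J[OF that] simp: algebra_simps)
  have left: "\<bar>?F s - ?F 0\<bar> \<le> (s\<^sup>2 / 2) powr (1 - 1 / q) *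
      (s\<^sup>2 * (3 - 2 * s) / 6 * \<alpha> + s ^ 3 / 3 * \<beta>) powr (1 / q)"
  \<comment> \<open>At \<open>s = 0\<close> the total weight is 0, outside the scope of the power
    mean lemma, but the increment vanishes. The case \<open>s = 1\<close> below is
    analogous.\<close>
  proof (cases "s = 0")
    case False
    show ?thesis
    proof (rule increment_le_power_mean[where F = ?F and c = 0 and d = s and w = "\<lambda>t. t" and k = k
          and p = "\<lambda>t. (1 - t) * \<alpha> + t * \<beta>"])
      have "((\<lambda>t::real. t) has_integral s\<^sup>2 / 2 - 0\<^sup>2 / 2) {0..s}"
        using s by (intro has_integral_real_FTC) (auto intro!: derivative_eq_intros)
      then show "((\<lambda>t::real. \<bar>t\<bar>) has_integral s\<^sup>2 / 2) {0..s}"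
        by (auto intro: has_integral_eq)
      \<comment> \<open>The antiderivative of \<open>t * ((1 - t) * \<alpha> + t * \<beta>)\<close>
        that vanishes at 0.\<close>
      let ?P = "\<lambda>t. t\<^sup>2 * (3 - 2 * t) / 6 * \<alpha> + t ^ 3 / 3 * \<beta>"
      have "((\<lambda>t. t * ((1 - t) * \<alpha> + t * \<beta>)) has_integral ?P s - ?P 0) {0..s}"
        using s by (intro has_integral_real_FTC)
          (auto intro!: derivative_eq_intros simp: field_simps power2_eq_square)
      then show "((\<lambda>t. \<bar>t\<bar> * ((1 - t) * \<alpha> + t * \<beta>)) has_integral ?P s) {0..s}"
        by (auto intro: has_integral_eq)
    next
      fix t assume "t \<in> {0..s}"
      with s show "(?F has_real_derivative t * k t) (at t within {0..s})"
        by (intro DERIV_subset[OF F]) auto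
    qed (use s q k False in auto)
  qed simp
  have right: "\<bar>?G 1 - ?G s\<bar> \<le> ((1 - s)\<^sup>2 / 2) powr (1 - 1 / q) *
      ((1 - s) ^ 3 / 3 * \<alpha> + (1 / 6 + s\<^sup>2 * (2 * s - 3) / 6) * \<beta>) powr (1 / q)"
  proof (cases "s = 1")
    case False
    show ?thesis
    proof (rule increment_le_power_mean[where F = ?G and c = s and d = 1 and w = "\<lambda>t. t - 1" and k = k
          and p = "\<lambda>t. (1 - t) * \<alpha> + t * \<beta>"])
      let ?R = "\<lambda>t::real. - ((1 - t)\<^sup>2 / 2)"
      have "((\<lambda>t::real. 1 - t) has_integral ?R 1 - ?R s) {s..1}"
        using s by (intro has_integral_real_FTC) (auto intro!: derivative_eq_intros simp: field_simps)
      then show "((\<lambda>t::real. \<bar>t - 1\<bar>) has_integral (1 - s)\<^sup>2 / 2) {s..1}"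
        by (auto intro: has_integral_eq[rotated])
      \<comment> \<open>Minus an antiderivative of
        \<open>(1 - t) * ((1 - t) * \<alpha> + t * \<beta>)\<close>; the constant 1 / 6 makes it
        vanish at 1.\<close>
      let ?P = "\<lambda>t. (1 - t) ^ 3 / 3 * \<alpha> + (1 / 6 + t\<^sup>2 * (2 * t - 3) / 6) * \<beta>"
      have "((\<lambda>t. (1 - t) * ((1 - t) * \<alpha> + t * \<beta>)) has_integral - ?P 1 - - ?P s) {s..1}"
        using s by (intro has_integral_real_FTC)
          (auto intro!: derivative_eq_intros simp: field_simps power2_eq_square)
      then show "((\<lambda>t. \<bar>t - 1\<bar> * ((1 - t) * \<alpha> + t * \<beta>)) has_integral ?P s) {s..1}"
        by (auto intro: has_integral_eq[rotated] simp: add.commute)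
    next
      fix t assume "t \<in> {s..1}"
      with s show "(?G has_real_derivative (t - 1) * k t) (at t within {s..1})"
        by (intro DERIV_subset[OF G]) auto
    qed (use s q k False in auto)
  qed simp
  \<comment> \<open>Here \<open>?F 0 = 0\<close> and
    \<open>?G 1 = - integral {0..1} g\<close>.\<close>
  have "g s - integral {0..1} g = (?F s - ?F 0) + (?G 1 - ?G s)"
    by (simp add: algebra_simps)
  also have "\<bar>\<dots>\<bar> \<le> \<bar>?F s - ?F 0\<bar> + \<bar>?G 1 - ?G s\<bar>" by (rule abs_triangle_ineq)
  also note add_mono[OF left right]
  finally show ?thesis
    using s by (simp add: half_square_powr algebra_simps)
qed

theorem theorem2p8:
  fixes A :: "real set" and \<eta> :: "real \<Rightarrow> real \<Rightarrow> real"
    and f f' :: "real \<Rightarrow> real" and a b q x :: real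
  assumes "open A"
    and "invex_wrt \<eta> A"
    and "a \<in> A" and "b \<in> A"
    and "a < a + \<eta> b a"
    and "\<And>u. u \<in> A \<Longrightarrow> (f has_real_derivative f' u) (at u)"
    and "q \<ge> 1"
    and "preinvex_on \<eta> (insert b {a..a + \<eta> b a}) (\<lambda>u. \<bar>f' u\<bar> powr q)"
    and "f' absolutely_integrable_on {a..a + \<eta> b a}"
    and "x \<in> {a..a + \<eta> b a}"
  shows "\<bar>f x - 1 / \<eta> b a * integral {a..a + \<eta> b a} f\<bar>
    \<le> \<eta> b a * (1 / 2) powr (1 - 1 / q) *
      ( ((x - a) / \<eta> b a) powr (2 * (1 - 1 / q)) *
          ( (x - a)^2 * (3 * \<eta> b a - 2 * x + 2 * a) / (6 * (\<eta> b a)^3) * \<bar>f' a\<bar> powr q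
            + 1 / 3 * ((x - a) / \<eta> b a)^3 * \<bar>f' b\<bar> powr q ) powr (1 / q)
      + ((a + \<eta> b a - x) / \<eta> b a) powr (2 * (1 - 1 / q)) *
          ( 1 / 3 * ((a + \<eta> b a - x) / \<eta> b a)^3 * \<bar>f' a\<bar> powr q
            + (1 / 6 + (x - a)^2 * (2 * x - 3 * \<eta> b a - 2 * a) / (6 * (\<eta> b a)^3)) * \<bar>f' b\<bar> powr q )
          powr (1 / q) )"
proof -
  let ?h = "\<eta> b a"
  define s where "s = (x - a) / ?h"
  have h: "?h > 0" using assms by simp
  have s: "s \<in> {0..1}" using assms h by (simp add: s_def divide_le_eq)
  have x: "x = a + s * ?h" using h by (simp add: s_def)
  let ?g = "\<lambda>t. f (a + t * ?h)" and ?k = "\<lambda>t. ?h * f' (a + t * ?h)"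
  \<comment> \<open>Invexity along the path from \<open>a\<close> towards \<open>b\<close> keeps the
    whole interval inside \<open>A\<close>, where \<open>f\<close> is differentiable.\<close>
  have A: "a + t * ?h \<in> A" if "t \<in> {0..1}" for t
    using assms(2-4) that unfolding invex_wrt_def by blast
  have der: "(?g has_real_derivative ?k t) (at t within {0..1})" if "t \<in> {0..1}" for t
  proof -
    have "(?g has_real_derivative f' (a + t * ?h) * ?h) (at t)"
      by (rule DERIV_chain2[where f = f and g = "\<lambda>t. a + t * \<eta> b a", OF assms(6)[OF A[OF that]]]) (auto intro!: derivative_eq_intros)
    then show ?thesis by (auto simp: mult.commute intro: has_field_derivative_at_within)
  qed
  \<comment> \<open>Preinvexity for the pair \<open>a\<close>, \<open>b\<close>; the chain rule
    factor \<open>?h\<close> contributes \<open>?h powr q\<close> to both endpoint values.\<close>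
  have k: "\<bar>?k t\<bar> powr q \<le> (1 - t) * (?h powr q * \<bar>f' a\<bar> powr q) + t * (?h powr q * \<bar>f' b\<bar> powr q)"
    if "t \<in> {0..1}" for t
  proof -
    have "a \<in> insert b {a..a + ?h}" using h by simp
    then have "\<bar>f' (a + t * ?h)\<bar> powr q \<le> (1 - t) * \<bar>f' a\<bar> powr q + t * \<bar>f' b\<bar> powr q"
      using assms(8) that unfolding preinvex_on_def by blast
    then have "?h powr q * \<bar>f' (a + t * ?h)\<bar> powr q
        \<le> ?h powr q * ((1 - t) * \<bar>f' a\<bar> powr q + t * \<bar>f' b\<bar> powr q)"
      by (intro mult_left_mono) auto
    then show ?thesis using h by (simp add: abs_mult powr_mult algebra_simps)
  qed
  \<comment> \<open>The factor \<open>?h powr q\<close> leaves each bracket as \<open>?h\<close>,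
    which becomes the leading factor of the bound.\<close>
  have scale: "((?h powr q) * c) powr (1 / q) = ?h * c powr (1 / q)" for c
    using h assms(7) by (simp add: powr_mult powr_powr)
  have int: "integral {0..1} ?g = 1 / ?h * integral {a..a + ?h} f"
  proof -
    have "continuous_on {a..a + ?h} f"
    proof (intro DERIV_continuous_on)
      fix u assume "u \<in> {a..a + ?h}"
      then have "a + (u - a) / ?h * ?h \<in> A" using h by (intro A) (simp add: divide_le_eq)
      then have "u \<in> A" using h by simp
      then show "(f has_real_derivative f' u) (at u within {a..a + ?h})"
        using assms(6) has_field_derivative_at_within by blast
    qed
    then have "(f has_integral integral {a..a + ?h} f) (cbox a (a + ?h))"
      using integrable_continuous_real integrable_integral by fastforce
    \<comment> \<open>The substitution \<open>u = a + t * ?h\<close>, under which the unit interval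
      is the preimage of \<open>{a..a + ?h}\<close>.\<close>
    from has_integral_affinity'[OF this h, of a] h show ?thesis
      by (simp add: integral_unique field_simps)
  qed
  have P: "(x - a)^2 * (3 * ?h - 2 * x + 2 * a) / (6 * ?h^3) = s\<^sup>2 * (3 - 2 * s) / 6"
    "(x - a)^2 * (2 * x - 3 * ?h - 2 * a) / (6 * ?h^3) = s\<^sup>2 * (2 * s - 3) / 6"
    "(a + ?h - x) / ?h = 1 - s"
    using h unfolding x by (simp_all add: field_simps power2_eq_square power3_eq_cube)
  let ?U = "s\<^sup>2 * (3 - 2 * s) / 6 * \<bar>f' a\<bar> powr q + 1 / 3 * s ^ 3 * \<bar>f' b\<bar> powr q"
  let ?V = "1 / 3 * (1 - s) ^ 3 * \<bar>f' a\<bar> powr q + (1 / 6 + s\<^sup>2 * (2 * s - 3) / 6) * \<bar>f' b\<bar> powr q"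
  have U: "s\<^sup>2 * (3 - 2 * s) / 6 * (?h powr q * \<bar>f' a\<bar> powr q) + s ^ 3 / 3 * (?h powr q * \<bar>f' b\<bar> powr q)
      = ?h powr q * ?U"
    and V: "(1 - s) ^ 3 / 3 * (?h powr q * \<bar>f' a\<bar> powr q)
        + (1 / 6 + s\<^sup>2 * (2 * s - 3) / 6) * (?h powr q * \<bar>f' b\<bar> powr q) = ?h powr q * ?V"
    by (simp_all add: algebra_simps)
  have "\<bar>?g s - integral {0..1} ?g\<bar> \<le> (1 / 2) powr (1 - 1 / q) *
      (s powr (2 * (1 - 1 / q)) * (?h * ?U powr (1 / q))
       + (1 - s) powr (2 * (1 - 1 / q)) * (?h * ?V powr (1 / q)))"
    using ostrowski_unit_interval[OF s assms(7) der k] unfolding U V scale by simp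
  also have "\<dots> = ?h * (1 / 2) powr (1 - 1 / q) *
      (s powr (2 * (1 - 1 / q)) * ?U powr (1 / q)
       + (1 - s) powr (2 * (1 - 1 / q)) * ?V powr (1 / q))"
    by (simp only: distrib_left mult.assoc mult.left_commute)
  finally show ?thesis
    unfolding int P s_def[symmetric] x[symmetric] .
qed

end
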